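(* For all $\alpha>0$, $k^t\in\mathbb{N}$, $k^d\in\mathbb{N}$, and for every sufficiently small $\varepsilon>0$, there is an instance $I$ of the relief distribution problem with $k^t$ trucks, $k^d$ drones and drone speed $\alpha$ such that $$\frac{\mathrm{Optimistic}(I)}{\mathrm{TSP}_{k^t,0}(C)}=\min\left\{1+\frac{1}{\alpha},\ \frac{1+\alpha}{1+\varepsilon}\right\},$$ where $C$ is the set of non-depot nodes of $I$.
   Context: Relief distribution problem (RDP). $\mathbb{N}=\{1,2,\dots\}$. An instance is $I=(k^t,k^d,\alpha,G,D)$: $k^t,k^d\in\mathbb{N}$ are the numbers of trucks and drones; $\alpha>0$ is the drone speed; $G=(V,E,c)$ is a finite connected undirected graph (not necessarily complete) with $V=\{v_0\}\cup C$, where $v_0$ is the depot and $C\neq\emptyset$ is the set of non-depot nodes; edge lengths $c(i,j)>0$ satisfy the triangle inequality; $D\subseteq C$ is the set of damaged nodes, initially unknown; the status of a node is revealed when some vehicle first arrives at it. For non-adjacent $i,j$, $c(i,j)$ is the shortest-path distance. A truck needs time $c(i,j)$ to traverse an edge, a drone needs $\frac1\alpha c(i,j)$. A tour is a closed walk in $G$ starting and ending at $v_0$ (possibly of length $0$); it visits all nodes lying on it. The makespan of a family of tours is the maximum duration of a tour. For integers $m,n\ge 0$ with $m+n\ge1$ and $W\subseteq C$, $\mathrm{TSP}_{m,n}(W)$ denotes the minimum makespan over all families of $m$ truck tours and $n$ drone tours that together visit all nodes of $W$, and $S^*_{m,n}(W)$ denotes an optimal such family. Policy Optimistic (deterministic;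 optimal families are selected by a fixed rule based only on the information available at that time, so the first-stage tours do not depend on $D$). First stage: the vehicles execute the tours of $S^*_{k^t,k^d}(C)$ and return to the depot. Let $D^d\subseteq D$ be the set of damaged nodes not visited by truck tours in this stage. Second stage (after all vehicles returned): the trucks execute $S^*_{k^t,0}(D^d)$. Its makespan is $\mathrm{Optimistic}(I)=\mathrm{TSP}_{k^t,k^d}(C)+\mathrm{TSP}_{k^t,0}(D^d)$. *)

theory Defs
  imports Complex_Main
begin

section \<open>Graphs with a depot\<close>

record 'v network =
  depot :: 'v
  sites :: "'v set"
  edges :: "'v set set"
  cost  :: "'v \<Rightarrow> 'v \<Rightarrow> real"

definition verts :: "('v, 'x) network_scheme \<Rightarrow> 'v set" where
  "verts G = insert (depot G) (sites G)"

definition walk :: "('v, 'x) network_scheme \<Rightarrow> 'v list \<Rightarrow> bool" where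
  "walk G p \<longleftrightarrow> p \<noteq> [] \<and> set p \<subseteq> verts G \<and> successively (\<lambda>u v. {u, v} \<in> edges G) p"

definition walk_betw :: "('v, 'x) network_scheme \<Rightarrow> 'v \<Rightarrow> 'v list \<Rightarrow> 'v \<Rightarrow> bool" where
  "walk_betw G u p v \<longleftrightarrow> walk G p \<and> hd p = u \<and> last p = v"

definition walk_length :: "('v, 'x) network_scheme \<Rightarrow> 'v list \<Rightarrow> real" where
  "walk_length G p = (\<Sum>(u, v) \<leftarrow> zip p (tl p). cost G u v)"

definition sp_dist :: "('v, 'x) network_scheme \<Rightarrow> 'v \<Rightarrow> 'v \<Rightarrow> real" where
  "sp_dist G u v = Inf {walk_length G p | p. walk_betw G u p v}"

text \<open>
  The function \<open>cost\<close> is the edge length on edges and the shortest-path distance on all other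
  pairs of vertices (in particular it is \<open>0\<close> on the diagonal, as there are no loops). The triangle
  inequality is required of this extended function, so that an edge is never longer than a detour.
\<close>

definition rdp_graph :: "('v, 'x) network_scheme \<Rightarrow> bool" where
  "rdp_graph G \<longleftrightarrow>
     finite (sites G) \<and> sites G \<noteq> {} \<and> depot G \<notin> sites G \<and>
     (\<forall>e \<in> edges G. e \<subseteq> verts G \<and> card e = 2) \<and>
     (\<forall>u \<in> verts G. \<forall>v \<in> verts G. \<exists>p. walk_betw G u p v) \<and>
     (\<forall>u \<in> verts G. \<forall>v \<in> verts G. cost G u v = cost G v u) \<and>
     (\<forall>u \<in> verts G. \<forall>v \<in> verts G. {u, v} \<in> edges G \<longrightarrow> cost G u v > 0) \<and>
     (\<forall>u \<in> verts G. \<forall>v \<in> verts G. {u, v} \<notin> edges G \<longrightarrow> cost G u v = sp_dist G u v) \<and>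
     (\<forall>u \<in> verts G. \<forall>v \<in> verts G. \<forall>w \<in> verts G. cost G u w \<le> cost G u v + cost G v w)"


section \<open>Tours, families of tours and optimal families\<close>

definition tour :: "('v, 'x) network_scheme \<Rightarrow> 'v list \<Rightarrow> bool" where
  "tour G p \<longleftrightarrow> walk_betw G (depot G) p (depot G)"

text \<open>The truck tours and the drone tours of a family, one for each vehicle.\<close>

type_synonym 'v family = "'v list list \<times> 'v list list"

definition durations :: "real \<Rightarrow> ('v, 'x) network_scheme \<Rightarrow> 'v family \<Rightarrow> real set" where
  "durations \<alpha> G F =
     walk_length G ` set (fst F) \<union> (\<lambda>p. 1 / \<alpha> * walk_length G p) ` set (snd F)"

definition makespan :: "real \<Rightarrow> ('v, 'x) network_scheme \<Rightarrow> 'v family \<Rightarrow> real" where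
  "makespan \<alpha> G F = Max (durations \<alpha> G F)"

definition visited :: "'v list list \<Rightarrow> 'v set" where
  "visited ps = (\<Union>p \<in> set ps. set p)"

definition covering_family ::
  "('v, 'x) network_scheme \<Rightarrow> nat \<Rightarrow> nat \<Rightarrow> 'v set \<Rightarrow> 'v family \<Rightarrow> bool" where
  "covering_family G m n W F \<longleftrightarrow>
     length (fst F) = m \<and> length (snd F) = n \<and>
     (\<forall>p \<in> set (fst F) \<union> set (snd F). tour G p) \<and>
     W \<subseteq> visited (fst F) \<union> visited (snd F)"

definition optimal_family ::
  "real \<Rightarrow> ('v, 'x) network_scheme \<Rightarrow> nat \<Rightarrow> nat \<Rightarrow> 'v set \<Rightarrow> 'v family \<Rightarrow> bool" where
  "optimal_family \<alpha> G m n W F \<longleftrightarrow>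
     covering_family G m n W F \<and>
     (\<forall>F'. covering_family G m n W F' \<longrightarrow> makespan \<alpha> G F \<le> makespan \<alpha> G F')"

text \<open>The infimum is attained, see \<open>optimal_family_exists\<close> and \<open>TSP_eq_makespan\<close> below.\<close>

definition TSP :: "real \<Rightarrow> ('v, 'x) network_scheme \<Rightarrow> nat \<Rightarrow> nat \<Rightarrow> 'v set \<Rightarrow> real" where
  "TSP \<alpha> G m n W = Inf {makespan \<alpha> G F | F. covering_family G m n W F}"


section \<open>Instances and the policy Optimistic\<close>

definition rdp_instance ::
  "nat \<Rightarrow> nat \<Rightarrow> real \<Rightarrow> ('v, 'x) network_scheme \<Rightarrow> 'v set \<Rightarrow> bool" where
  "rdp_instance kt kd \<alpha> G D \<longleftrightarrow> kt \<ge> 1 \<and> kd \<ge> 1 \<and> \<alpha> > 0 \<and> rdp_graph G \<and> D \<subseteq> sites G"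

text \<open>
  A rule selecting the first-stage tours sees everything except the set of damaged nodes. It may
  pick any optimal family. No rule is needed for the second stage, because the makespan of that
  stage does not depend on which optimal family is executed.
\<close>

type_synonym 'v rule = "nat \<Rightarrow> nat \<Rightarrow> real \<Rightarrow> 'v network \<Rightarrow> 'v family"

definition selection_rule :: "'v rule \<Rightarrow> bool" where
  "selection_rule S \<longleftrightarrow>
     (\<forall>kt kd \<alpha> G. kt \<ge> 1 \<longrightarrow> kd \<ge> 1 \<longrightarrow> \<alpha> > 0 \<longrightarrow> rdp_graph G \<longrightarrow>
        optimal_family \<alpha> G kt kd (sites G) (S kt kd \<alpha> G))"

definition second_stage_nodes ::
  "'v rule \<Rightarrow> nat \<Rightarrow> nat \<Rightarrow> real \<Rightarrow> 'v network \<Rightarrow> 'v set \<Rightarrow> 'v set" where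
  "second_stage_nodes S kt kd \<alpha> G D = D - visited (fst (S kt kd \<alpha> G))"

definition optimistic ::
  "'v rule \<Rightarrow> nat \<Rightarrow> nat \<Rightarrow> real \<Rightarrow> 'v network \<Rightarrow> 'v set \<Rightarrow> real" where
  "optimistic S kt kd \<alpha> G D =
     TSP \<alpha> G kt kd (sites G) + TSP \<alpha> G kt 0 (second_stage_nodes S kt kd \<alpha> G D)"


section \<open>Optimal families exist\<close>

lemma walk_length_Nil [simp]: "walk_length G [] = 0"
  and walk_length_single [simp]: "walk_length G [u] = 0"
  and walk_length_Cons2 [simp]:
    "walk_length G (u # v # p) = cost G u v + walk_length G (v # p)"
  by (simp_all add: walk_length_def)

lemma edge_cost_lower_bound:
  assumes "rdp_graph G"
  obtains \<delta> where "\<delta> > 0"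
    "\<And>u v. u \<in> verts G \<Longrightarrow> v \<in> verts G \<Longrightarrow> {u, v} \<in> edges G \<Longrightarrow> \<delta> \<le> cost G u v"
proof -
  let ?A = "{(u, v). u \<in> verts G \<and> v \<in> verts G \<and> {u, v} \<in> edges G}"
  let ?B = "insert 1 ((\<lambda>(u, v). cost G u v) ` ?A)"
  have "finite (verts G)" using assms by (simp add: rdp_graph_def verts_def)
  then have fin: "finite ?B"
    using finite_subset[of ?A "verts G \<times> verts G"] by auto
  have "Min ?B \<in> ?B" by (rule Min_in) (use fin in auto)
  then have "Min ?B > 0" using assms by (auto simp: rdp_graph_def)
  moreover have "Min ?B \<le> cost G u v"
    if "u \<in> verts G" "v \<in> verts G" "{u, v} \<in> edges G" for u v
    using that by (intro Min_le fin) auto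
  ultimately show thesis by (rule that)
qed

lemma walk_length_ge:
  assumes "\<And>u v. u \<in> verts G \<Longrightarrow> v \<in> verts G \<Longrightarrow> {u, v} \<in> edges G \<Longrightarrow> \<delta> \<le> cost G u v"
    and "walk G p"
  shows "\<delta> * (real (length p) - 1) \<le> walk_length G p"
  using assms(2)
proof (induction p rule: induct_list012)
  case (3 u v p)
  then have "\<delta> * (real (length (v # p)) - 1) \<le> walk_length G (v # p)" "\<delta> \<le> cost G u v"
    by (auto simp: walk_def intro!: assms(1))
  then show ?case by (simp add: algebra_simps)
qed (auto simp: walk_def)

lemma finite_short_tours:
  assumes "rdp_graph G"
  shows "finite {p. tour G p \<and> walk_length G p \<le> B}"
proof -
  obtain \<delta> where \<delta>: "\<delta> > 0"
    "\<And>u v. u \<in> verts G \<Longrightarrow> v \<in> verts G \<Longrightarrow> {u, v} \<in> edges G \<Longrightarrow> \<delta> \<le> cost G u v"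
    using edge_cost_lower_bound[OF assms] by blast
  have "length p \<le> nat \<lceil>B / \<delta> + 1\<rceil>" if "tour G p" "walk_length G p \<le> B" for p
  proof -
    have "walk G p" using that by (simp add: tour_def walk_betw_def)
    from walk_length_ge[OF \<delta>(2) this] that(2) have "\<delta> * (real (length p) - 1) \<le> B" by linarith
    then have "real (length p) \<le> B / \<delta> + 1" using \<delta>(1) by (simp add: field_simps)
    then show ?thesis by linarith
  qed
  then have "{p. tour G p \<and> walk_length G p \<le> B} \<subseteq>
      {p. set p \<subseteq> verts G \<and> length p \<le> nat \<lceil>B / \<delta> + 1\<rceil>}"
    by (auto simp: tour_def walk_betw_def walk_def)
  moreover have "finite (verts G)" using assms by (simp add: rdp_graph_def verts_def)
  ultimately show ?thesis using finite_lists_length_le finite_subset by blast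
qed

lemma walk_betw_append:
  assumes "walk_betw G u p v" "walk_betw G v q w"
  shows "walk_betw G u (p @ tl q) w"
proof (cases "tl q = []")
  case True
  with assms show ?thesis by (cases q) (simp_all add: walk_betw_def walk_def)
next
  case False
  then obtain q' where "q = v # q'" "q' \<noteq> []"
    using assms(2) by (cases q) (simp_all add: walk_betw_def)
  with assms show ?thesis
    by (simp add: walk_betw_def walk_def successively_append_iff successively_Cons)
qed

lemma tour_covering_exists:
  assumes "rdp_graph G" "W \<subseteq> sites G"
  shows "\<exists>p. tour G p \<and> W \<subseteq> set p"
proof -
  have "finite W" using assms finite_subset by (auto simp: rdp_graph_def)
  then show ?thesis using assms(2)
  proof (induction W rule: finite_induct)
    case empty
    show ?case
      by (rule exI[of _ "[depot G]"]) (simp add: tour_def walk_betw_def walk_def verts_def)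
  next
    case (insert w W)
    then obtain p where p: "tour G p" "W \<subseteq> set p" by auto
    have "w \<in> verts G" "depot G \<in> verts G" using insert by (auto simp: verts_def)
    moreover have "\<forall>u \<in> verts G. \<forall>v \<in> verts G. \<exists>p. walk_betw G u p v"
      using assms(1) unfolding rdp_graph_def by (elim conjE)
    ultimately obtain q r where q: "walk_betw G (depot G) q w" and r: "walk_betw G w r (depot G)"
      by meson
    define s where "s = q @ tl r"
    have s: "walk_betw G (depot G) s (depot G)"
      unfolding s_def by (rule walk_betw_append[OF q r])
    have "w \<in> set s" using q by (auto simp: s_def walk_betw_def walk_def)
    moreover have "s = depot G # tl s" using s by (cases s) (auto simp: walk_betw_def walk_def)
    ultimately have "w = depot G \<or> w \<in> set (tl s)" by (metis set_ConsD)
    moreover have "depot G \<in> set p" using p(1) hd_in_set unfolding tour_def walk_betw_def walk_def by metis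
    moreover have "tour G (p @ tl s)"
      using walk_betw_append[OF _ s] p(1) by (simp add: tour_def)
    ultimately show ?case using p(2) by (intro exI[of _ "p @ tl s"]) auto
  qed
qed

lemma covering_family_exists:
  assumes "rdp_graph G" "W \<subseteq> sites G" "m + n \<ge> 1"
  shows "\<exists>F. covering_family G m n W F"
proof -
  obtain p where p: "tour G p" "W \<subseteq> set p" using tour_covering_exists[OF assms(1,2)] by blast
  then have "covering_family G m n W (replicate m p, replicate n p)"
    using assms(3) by (auto simp: covering_family_def visited_def)
  then show ?thesis ..
qed

lemma finite_short_families:
  assumes "rdp_graph G" "\<alpha> > 0"
  shows "finite {F. covering_family G m n W F \<and> makespan \<alpha> G F \<le> B}"
proof -
  let ?L = "\<lambda>B k. {ps. set ps \<subseteq> {p. tour G p \<and> walk_length G p \<le> B} \<and> length ps = k}"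
  have "{F. covering_family G m n W F \<and> makespan \<alpha> G F \<le> B} \<subseteq> ?L B m \<times> ?L (\<alpha> * B) n"
  proof (rule subsetI)
    fix F assume F_in: "F \<in> {F. covering_family G m n W F \<and> makespan \<alpha> G F \<le> B}"
    obtain T U where TU: "F = (T, U)" by fastforce
    have F: "covering_family G m n W (T, U)" "makespan \<alpha> G (T, U) \<le> B"
      using F_in TU by auto
    have "x \<le> B" if "x \<in> durations \<alpha> G (T, U)" for x
      using F(2) Max_ge[OF _ that] by (auto simp: makespan_def durations_def)
    then have "\<forall>p \<in> set T. walk_length G p \<le> B" "\<forall>p \<in> set U. 1 / \<alpha> * walk_length G p \<le> B"
      by (auto simp: durations_def)
    then show "F \<in> ?L B m \<times> ?L (\<alpha> * B) n"
      unfolding TU using F(1) assms(2) by (auto simp: covering_family_def field_simps)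
  qed
  moreover have "finite (?L B m \<times> ?L (\<alpha> * B) n)"
    by (intro finite_cartesian_product finite_lists_length_eq finite_short_tours assms)
  ultimately show ?thesis by (rule finite_subset)
qed

lemma optimal_family_exists:
  assumes "rdp_graph G" "\<alpha> > 0" "W \<subseteq> sites G" "m + n \<ge> 1"
  shows "\<exists>F. optimal_family \<alpha> G m n W F"
proof -
  obtain F0 where F0: "covering_family G m n W F0"
    using covering_family_exists[OF assms(1,3,4)] by blast
  let ?A = "{F. covering_family G m n W F \<and> makespan \<alpha> G F \<le> makespan \<alpha> G F0}"
  have "finite ?A" by (rule finite_short_families[OF assms(1,2)])
  moreover have "?A \<noteq> {}" using F0 by blast
  ultimately have "arg_min_on (makespan \<alpha> G) ?A \<in> ?A"
    "\<not> (\<exists>F \<in> ?A. makespan \<alpha> G F < makespan \<alpha> G (arg_min_on (makespan \<alpha> G) ?A))"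
    by (rule arg_min_if_finite)+
  then obtain F where "F \<in> ?A" "\<forall>F' \<in> ?A. makespan \<alpha> G F \<le> makespan \<alpha> G F'"
    using not_less by blast
  then have F: "covering_family G m n W F" "makespan \<alpha> G F \<le> makespan \<alpha> G F0"
    "\<And>F'. covering_family G m n W F' \<Longrightarrow> makespan \<alpha> G F' \<le> makespan \<alpha> G F0 \<Longrightarrow>
      makespan \<alpha> G F \<le> makespan \<alpha> G F'"
    by blast+
  have "makespan \<alpha> G F \<le> makespan \<alpha> G F'" if "covering_family G m n W F'" for F'
    using F(2) F(3)[OF that] by linarith
  with F(1) show ?thesis unfolding optimal_family_def by blast
qed

lemma TSP_eq_makespan:
  assumes "optimal_family \<alpha> G m n W F"
  shows "TSP \<alpha> G m n W = makespan \<alpha> G F"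
proof -
  have "covering_family G m n W F" using assms by (simp add: optimal_family_def)
  then have "makespan \<alpha> G F \<in> {makespan \<alpha> G F | F. covering_family G m n W F}" by blast
  moreover have "makespan \<alpha> G F \<le> x" if "x \<in> {makespan \<alpha> G F | F. covering_family G m n W F}" for x
    using that assms by (auto simp only: optimal_family_def)
  ultimately show ?thesis unfolding TSP_def by (rule cInf_eq_minimum)
qed

lemma selection_rule_exists: "\<exists>S. selection_rule S"
proof
  show "selection_rule (\<lambda>kt kd \<alpha> G. SOME F. optimal_family \<alpha> G kt kd (sites G) F)"
    unfolding selection_rule_def
    by (intro allI impI, rule someI_ex, rule optimal_family_exists) simp_all
qed

end

theory Submission
  imports Defs
begin

text \<open>
  If \<open>\<alpha> > 1\<close>, a single site at distance \<open>\<alpha> / 2\<close> is enough: a drone serves it in time \<open>1\<close>, so no truck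
  visits it in the first stage, and a truck needs time \<open>\<alpha>\<close> afterwards; the ratio is \<open>(1 + \<alpha>) / \<alpha>\<close>.

  If \<open>\<alpha> \<le> 1\<close>, take one site per truck at distance \<open>1 / 2\<close> and one more site at distance
  \<open>\<alpha> / 2\<close>, where a tour through two sites costs \<open>\<epsilon>\<close> more than a tour through the farther one. The
  trucks alone need \<open>1 + \<epsilon>\<close>, because some truck has to visit two sites. With the drones the makespan
  is \<open>1\<close>, so every truck visits at most one site and some site is left to a drone. A drone reaches
  only distance \<open>\<alpha> / 2\<close> in that time, so the second stage takes \<open>\<alpha>\<close>.
\<close>

section \<open>Bounds on the makespan\<close>

lemma finite_durations: "finite (durations \<alpha> G F)"
  by (simp add: durations_def)

lemma makespan_ge_truck: "p \<in> set (fst F) \<Longrightarrow> walk_length G p \<le> makespan \<alpha> G F"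
  unfolding makespan_def by (rule Max_ge[OF finite_durations]) (simp add: durations_def)

lemma makespan_ge_drone: "p \<in> set (snd F) \<Longrightarrow> 1 / \<alpha> * walk_length G p \<le> makespan \<alpha> G F"
  unfolding makespan_def by (rule Max_ge[OF finite_durations]) (auto simp: durations_def)

lemma makespan_le:
  assumes "fst F \<noteq> []"
    and "\<And>p. p \<in> set (fst F) \<Longrightarrow> walk_length G p \<le> t"
    and "\<And>p. p \<in> set (snd F) \<Longrightarrow> 1 / \<alpha> * walk_length G p \<le> t"
  shows "makespan \<alpha> G F \<le> t"
proof -
  have "durations \<alpha> G F \<noteq> {}" using assms(1) by (simp add: durations_def)
  moreover have "\<forall>x \<in> durations \<alpha> G F. x \<le> t" using assms(2,3) by (auto simp: durations_def)
  ultimately show ?thesis unfolding makespan_def by (simp add: Max_le_iff[OF finite_durations])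
qed

lemma TSP_eqI:
  assumes "covering_family G m n W F" "makespan \<alpha> G F \<le> t"
    and "\<And>F'. covering_family G m n W F' \<Longrightarrow> t \<le> makespan \<alpha> G F'"
  shows "TSP \<alpha> G m n W = t"
proof -
  have "t = makespan \<alpha> G F" using assms by (intro antisym)
  then have "optimal_family \<alpha> G m n W F" using assms by (simp add: optimal_family_def)
  then show ?thesis using TSP_eq_makespan \<open>t = makespan \<alpha> G F\<close> by metis
qed

lemma covering_family_visits:
  assumes "covering_family G m n W F" "w \<in> W"
  obtains (truck) p where "p \<in> set (fst F)" "tour G p" "w \<in> set p"
  | (drone) p where "p \<in> set (snd F)" "tour G p" "w \<in> set p"
  using assms unfolding covering_family_def visited_def by blast

lemma walk_prefix: "walk G (p @ q) \<Longrightarrow> p \<noteq> [] \<Longrightarrow> walk G p"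
  by (auto simp: walk_def successively_append_iff)

text \<open>Picking for each element of \<open>W\<close> a tour that visits it gives a map into
  \<open>set ps\<close>, which has fewer elements than \<open>W\<close>, so the map is not
  injective.\<close>

lemma visited_pigeonhole:
  assumes "W \<subseteq> visited ps" "length ps < card W"
  obtains p u w where "p \<in> set ps" "u \<in> W" "w \<in> W" "u \<noteq> w" "u \<in> set p" "w \<in> set p"
proof -
  obtain f where f: "\<And>w. w \<in> W \<Longrightarrow> f w \<in> set ps \<and> w \<in> set (f w)"
    using assms(1) unfolding visited_def by (metis UN_E subsetD)
  have "card (f ` W) \<le> card (set ps)" using f by (intro card_mono) auto
  also have "\<dots> < card W" using card_length[of ps] assms(2) by linarith
  finally have "\<not> inj_on f W" using pigeonhole by blast
  then obtain u w where "u \<in> W" "w \<in> W" "u \<noteq> w" "f u = f w" unfolding inj_on_def by blast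
  with f show thesis by (metis that)
qed

section \<open>Radial networks\<close>

text \<open>
  The function \<open>r\<close> prescribes the distances to the depot, and \<open>\<epsilon>\<close> is the extra length of a tour
  through two sites compared to a tour through the farther one.
\<close>

definition radial_network :: "nat \<Rightarrow> (nat \<Rightarrow> real) \<Rightarrow> real \<Rightarrow> nat network" where
  "radial_network n r \<epsilon> =
     \<lparr>depot = 0, sites = {1..n}, edges = {{u, v} | u v. u \<le> n \<and> v \<le> n \<and> u \<noteq> v},
      cost = (\<lambda>u v. \<bar>r u - r v\<bar> + (if u \<noteq> v \<and> u \<noteq> 0 \<and> v \<noteq> 0 then \<epsilon> else 0))\<rparr>"

text \<open>A detour between two sites through the depot has length \<open>r u + r w\<close>, which
  must not beat the direct \<open>\<bar>r u - r w\<bar> + \<epsilon>\<close>; this is the origin of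
  the bound \<open>\<epsilon> \<le> 2 * r u\<close>.\<close>

locale radial =
  fixes n :: nat and r :: "nat \<Rightarrow> real" and \<epsilon> :: real
  assumes n_pos: "n \<ge> 1" and eps_pos: "\<epsilon> > 0" and r_0: "r 0 = 0"
    and eps_le: "\<And>u. 1 \<le> u \<Longrightarrow> u \<le> n \<Longrightarrow> \<epsilon> \<le> 2 * r u"
begin

abbreviation "G \<equiv> radial_network n r \<epsilon>"

lemma G_simps [simp]:
  "depot G = 0" "sites G = {1..n}" "verts G = {..n}"
  "cost G u v = \<bar>r u - r v\<bar> + (if u \<noteq> v \<and> u \<noteq> 0 \<and> v \<noteq> 0 then \<epsilon> else 0)"
  by (auto simp: radial_network_def verts_def)

lemma edge_iff [simp]: "{u, v} \<in> edges G \<longleftrightarrow> u \<le> n \<and> v \<le> n \<and> u \<noteq> v"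
  by (auto simp: radial_network_def doubleton_eq_iff)

lemma r_pos: "1 \<le> u \<Longrightarrow> u \<le> n \<Longrightarrow> r u > 0"
  using eps_le[of u] eps_pos by linarith

lemma cost_triangle:
  assumes "u \<le> n" "v \<le> n" "w \<le> n"
  shows "cost G u w \<le> cost G u v + cost G v w"
proof (cases "u \<noteq> 0 \<and> w \<noteq> 0 \<and> v = 0")
  case True
  then have "\<epsilon> \<le> 2 * r u" "\<epsilon> \<le> 2 * r w" using eps_le assms by simp_all
  then show ?thesis using True r_0 eps_pos by (simp add: abs_if)
next
  \<comment> \<open>Here, if the direct edge carries the surcharge \<open>\<epsilon>\<close>, then
    some leg of the detour carries it too.\<close>
  case False
  then show ?thesis using eps_pos r_0 by (auto simp: abs_if)
qed

lemma cost_le_walk_length: "walk G p \<Longrightarrow> cost G (hd p) (last p) \<le> walk_length G p"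
proof (induction p rule: induct_list012)
  case (3 u v p)
  from 3 have w: "walk G (v # p)" by (auto simp: walk_def)
  moreover have "u \<le> n" "v \<le> n" "last (v # p) \<le> n"
    using "3.prems" last_in_set[of "v # p"] unfolding walk_def by auto
  ultimately have "cost G u (last (v # p)) \<le> cost G u v + cost G v (last (v # p))"
    by (intro cost_triangle)
  with "3.IH"(2)[OF w] show ?case by (simp del: G_simps)
qed (auto simp: walk_def)

lemma rdp_graph: "rdp_graph G"
proof -
  \<comment> \<open>The graph is complete, so the shortest-path requirement on non-adjacent pairs
    only concerns the diagonal.\<close>
  have diag: "sp_dist G u u = 0" if "u \<le> n" for u
    unfolding sp_dist_def
  proof (rule cInf_eq_minimum)
    show "0 \<in> {walk_length G p | p. walk_betw G u p u}"
      using that by (intro CollectI exI[of _ "[u]"]) (simp add: walk_betw_def walk_def)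
    show "0 \<le> x" if x: "x \<in> {walk_length G p | p. walk_betw G u p u}" for x
    proof -
      obtain p where "x = walk_length G p" "walk G p" "hd p = u" "last p = u"
        using x by (auto simp: walk_betw_def)
      with cost_le_walk_length[of p] show ?thesis by simp
    qed
  qed
  have conn: "\<exists>p. walk_betw G u p v" if "u \<le> n" "v \<le> n" for u v
    using that
    by (intro exI[of _ "if u = v then [u] else [u, v]"]) (simp add: walk_betw_def walk_def)
  have pos: "cost G u v > 0" if "u \<le> n" "v \<le> n" "u \<noteq> v" for u v
    using that r_pos[of u] r_pos[of v] eps_pos r_0 by (cases "u = 0"; cases "v = 0") auto
  have "\<forall>e \<in> edges G. e \<subseteq> {..n} \<and> card e = 2" by (auto simp: radial_network_def)
  moreover have "cost G u v = cost G v u" for u v by auto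
  ultimately show ?thesis
    unfolding rdp_graph_def using n_pos diag conn pos cost_triangle
    by (auto simp del: G_simps(4)) (simp add: diag)
qed

section \<open>Lower bounds on the length of a tour\<close>

lemma walk_length_append:
  "walk_length G (xs @ u # ys) = walk_length G (xs @ [u]) + walk_length G (u # ys)"
  by (induction xs rule: induct_list012) simp_all

text \<open>Cutting a tour at an occurrence of \<open>u\<close> leaves two walks between
  \<open>u\<close> and the depot, each at least as long as the cost between its ends.\<close>

lemma tour_length_split:
  assumes "tour G (xs @ u # ys)"
  shows "r u \<le> walk_length G (xs @ [u])" "r u \<le> walk_length G (u # ys)"
    and "walk_length G (xs @ u # ys) = walk_length G (xs @ [u]) + walk_length G (u # ys)"
    and "walk G (u # ys)" "last (u # ys) = 0"
proof -
  have w: "walk G (xs @ [u])" "hd (xs @ [u]) = 0" and w': "walk G (u # ys)" "last (u # ys) = 0"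
    using assms by (auto simp: tour_def walk_betw_def walk_def successively_append_iff
        successively_Cons hd_append split: if_splits)
  show "r u \<le> walk_length G (xs @ [u])" using cost_le_walk_length[OF w(1)] w(2) r_0 by simp
  show "r u \<le> walk_length G (u # ys)"
    using cost_le_walk_length[OF w'(1)] w'(2) r_0 by (simp del: last.simps)
  show "walk_length G (xs @ u # ys) = walk_length G (xs @ [u]) + walk_length G (u # ys)"
    by (rule walk_length_append)
  show "walk G (u # ys)" "last (u # ys) = 0" by fact+
qed

lemma tour_length_ge:
  assumes "tour G p" "u \<in> set p"
  shows "2 * r u \<le> walk_length G p"
proof -
  obtain xs ys where "p = xs @ u # ys" using assms(2) by (meson split_list)
  then show ?thesis using tour_length_split[of xs u ys] assms(1) by simp
qed

text \<open>Cutting at both sites gives three pieces of length at least \<open>r u\<close>,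
  \<open>\<bar>r u - r w\<bar> + \<epsilon>\<close> and \<open>r w\<close>; these bounds add up to
  \<open>2 * max (r u) (r w) + \<epsilon>\<close>.\<close>

lemma tour_length_ge_two:
  assumes "tour G p" "u \<in> set p" "w \<in> set p" "u \<noteq> w" "u \<noteq> 0" "w \<noteq> 0"
  shows "2 * r u + \<epsilon> \<le> walk_length G p"
proof -
  \<comment> \<open>The bound is symmetric in \<open>a\<close> and \<open>b\<close>, so it serves
    both orders of the two sites along the tour.\<close>
  have *: "a + b + \<bar>a - b\<bar> + \<epsilon> \<le> walk_length G p"
    if p: "p = xs @ x # ys" and y: "y \<in> set ys" and xy: "x \<noteq> y" "x \<noteq> 0" "y \<noteq> 0"
      and ab: "a = r x" "b = r y"
    for xs x ys y a b
  proof -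
    obtain ys' zs where ys: "ys = ys' @ y # zs" using y by (meson split_list)
    have t: "tour G (xs @ x # ys' @ y # zs)" "tour G ((xs @ x # ys') @ y # zs)"
      using assms(1) p ys by simp_all
    note split = tour_length_split[OF t(1)] tour_length_split[OF t(2)]
    have "walk G (x # ys' @ [y])"
      using split(4) walk_prefix[of G "x # ys' @ [y]" zs] by simp
    from cost_le_walk_length[OF this] have "\<bar>r x - r y\<bar> + \<epsilon> \<le> walk_length G (x # ys' @ [y])"
      using xy by simp
    moreover have "walk_length G (x # ys' @ y # zs)
        = walk_length G (x # ys' @ [y]) + walk_length G (y # zs)"
      using walk_length_append[of "x # ys'" y zs] by simp
    ultimately show ?thesis using split(1,3,7) p ys ab by simp
  qed
  obtain xs ys where p: "p = xs @ u # ys" using assms(2) by (meson split_list)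
  consider "w \<in> set ys" | "w \<in> set xs" using p assms(3,4) by auto
  then show ?thesis
  proof cases
    case 1
    show ?thesis using *[OF p 1 assms(4-6) refl refl] by linarith
  next
    case 2
    then obtain xs' zs where "p = xs' @ w # zs @ u # ys" using p by (auto dest!: split_list)
    from *[OF this _ _ assms(6,5) refl refl] assms(4) show ?thesis by auto
  qed
qed

lemma tour_site [simp]: "tour G [0, u, 0] \<longleftrightarrow> 1 \<le> u \<and> u \<le> n"
  by (auto simp: tour_def walk_betw_def walk_def)

lemma length_tour_site: "1 \<le> u \<Longrightarrow> u \<le> n \<Longrightarrow> walk_length G [0, u, 0] = 2 * r u"
  using r_pos[of u] r_0 by simp

text \<open>Sending all trucks along the same tour to \<open>w\<close> is optimal; this gives the
  length of the second stage when one damaged site is left.\<close>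

lemma TSP_single_site:
  assumes "1 \<le> w" "w \<le> n" "k \<ge> 1"
  shows "TSP \<alpha> G k 0 {w} = 2 * r w"
proof (rule TSP_eqI)
  show "covering_family G k 0 {w} (replicate k [0, w, 0], [])"
    using assms by (auto simp: covering_family_def visited_def)
  show "makespan \<alpha> G (replicate k [0, w, 0], []) \<le> 2 * r w"
    using assms by (intro makespan_le) (auto simp: length_tour_site simp del: walk_length_Cons2)
  fix F' assume F': "covering_family G k 0 {w} F'"
  then show "2 * r w \<le> makespan \<alpha> G F'"
  proof (rule covering_family_visits[of _ _ _ _ _ w])
    show "2 * r w \<le> makespan \<alpha> G F'" if "p \<in> set (fst F')" "tour G p" "w \<in> set p" for p
      using tour_length_ge[OF that(2,3)] makespan_ge_truck[OF that(1), of G \<alpha>] by linarith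
  qed (use F' in \<open>auto simp: covering_family_def\<close>)
qed

end

text \<open>These two facts are all that is used about the rule, so the arguments below apply to
  whichever optimal family it selects.\<close>

lemma rule_covering_makespan:
  assumes "selection_rule S" "rdp_instance kt kd \<alpha> G D"
  shows "covering_family G kt kd (sites G) (S kt kd \<alpha> G)"
    and "makespan \<alpha> G (S kt kd \<alpha> G) = TSP \<alpha> G kt kd (sites G)"
proof -
  have opt: "optimal_family \<alpha> G kt kd (sites G) (S kt kd \<alpha> G)"
    using assms by (simp add: selection_rule_def rdp_instance_def)
  then show "covering_family G kt kd (sites G) (S kt kd \<alpha> G)" by (simp add: optimal_family_def)
  show "makespan \<alpha> G (S kt kd \<alpha> G) = TSP \<alpha> G kt kd (sites G)"
    using TSP_eq_makespan[OF opt] by simp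
qed

section \<open>The two instances\<close>

lemma fast_drone_instance:
  fixes S :: "nat rule"
  assumes "\<alpha> > 1" "kt \<ge> 1" "kd \<ge> 1" "selection_rule S"
  obtains G D where "rdp_instance kt kd \<alpha> G D"
    "optimistic S kt kd \<alpha> G D = 1 + \<alpha>" "TSP \<alpha> G kt 0 (sites G) = \<alpha>"
proof -
  define r :: "nat \<Rightarrow> real" where "r u = (if u = 0 then 0 else \<alpha> / 2)" for u
  \<comment> \<open>The surcharge must not exceed \<open>2 * r 1 = \<alpha>\<close>; with a single
    site, \<open>\<alpha>\<close> itself serves.\<close>
  interpret radial "Suc 0" r \<alpha>
    using assms(1) by unfold_locales (auto simp: r_def)
  have inst: "rdp_instance kt kd \<alpha> G {1}"
    using assms rdp_graph by (simp add: rdp_instance_def)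
  have truck: "TSP \<alpha> G kt 0 {1} = \<alpha>"
    using TSP_single_site[of 1 kt \<alpha>] assms(2) by (simp add: r_def)
  have both: "TSP \<alpha> G kt kd {1} = 1"
  proof (rule TSP_eqI)
    \<comment> \<open>The trucks stay at the depot: a truck visit to the site would take time
      \<open>\<alpha> > 1\<close>.\<close>
    let ?F = "(replicate kt [0], replicate kd [0, 1, 0])"
    show "covering_family G kt kd {1} ?F"
      using assms by (auto simp: covering_family_def visited_def)
        (simp add: tour_def walk_betw_def walk_def)
    show "makespan \<alpha> G ?F \<le> 1"
      using assms by (intro makespan_le) (auto simp: r_def)
    fix F' assume "covering_family G kt kd {1} F'"
    then show "1 \<le> makespan \<alpha> G F'"
    proof (cases rule: covering_family_visits[of _ _ _ _ _ 1, consumes 1, case_names site truck drone])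
      case (truck p)
      then show ?thesis
        using tour_length_ge[of p 1] makespan_ge_truck[of p F' G \<alpha>] assms(1) by (simp add: r_def)
    next
      case (drone p)
      then have "\<alpha> \<le> walk_length G p" using tour_length_ge[of p 1] by (simp add: r_def)
      then have "1 \<le> 1 / \<alpha> * walk_length G p" using assms(1) by (simp add: field_simps)
      with drone show ?thesis using makespan_ge_drone[of p F' \<alpha> G] by linarith
    qed simp
  qed
  note F = rule_covering_makespan[OF assms(4) inst]
  have "1 \<notin> visited (fst (S kt kd \<alpha> G))"
  proof
    assume "1 \<in> visited (fst (S kt kd \<alpha> G))"
    then obtain p where p: "p \<in> set (fst (S kt kd \<alpha> G))" "1 \<in> set p"
      by (auto simp: visited_def)
    then have "tour G p" using F(1) by (simp add: covering_family_def)
    from tour_length_ge[OF this p(2)] makespan_ge_truck[OF p(1), of G \<alpha>] F(2) both assms(1)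
    show False by (simp add: r_def)
  qed
  then have "second_stage_nodes S kt kd \<alpha> G {1} = {1}" by (auto simp: second_stage_nodes_def)
  then have "optimistic S kt kd \<alpha> G {1} = 1 + \<alpha>"
    using truck both by (simp add: optimistic_def)
  with inst truck show thesis by (intro that[of G "{1}"]) simp_all
qed

text \<open>The rule does not see \<open>D\<close>, so the graph can be fixed first and the damaged
  site chosen afterwards among those that the selected truck tours miss.\<close>

lemma slow_drone_instance:
  fixes S :: "nat rule"
  assumes "\<alpha> \<le> 1" "0 < \<epsilon>" "\<epsilon> < \<alpha>" "kt \<ge> 1" "kd \<ge> 1" "selection_rule S"
  obtains G D where "rdp_instance kt kd \<alpha> G D"
    "optimistic S kt kd \<alpha> G D = 1 + \<alpha>" "TSP \<alpha> G kt 0 (sites G) = 1 + \<epsilon>"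
proof -
  define r :: "nat \<Rightarrow> real" where
    "r u = (if u = 0 then 0 else if u \<le> kt then 1 / 2 else \<alpha> / 2)" for u
  have \<alpha>: "\<alpha> > 0" using assms(2,3) by linarith
  interpret radial "Suc kt" r \<epsilon>
    using assms by unfold_locales (auto simp: r_def)
  \<comment> \<open>This serves twice: it bounds the trucks alone from below, and it shows that the
    first-stage trucks, with makespan \<open>1\<close>, miss a site.\<close>
  have two: "\<exists>p \<in> set ps. 1 + \<epsilon> \<le> walk_length G p"
    if "{1..Suc kt} \<subseteq> visited ps" "length ps = kt" "\<forall>p \<in> set ps. tour G p" for ps
  proof -
    have "length ps < card {1..Suc kt}" using that(2) by simp
    from visited_pigeonhole[OF that(1) this] obtain p u w where p: "p \<in> set ps"
      and uw: "u \<in> {1..Suc kt}" "w \<in> {1..Suc kt}" "u \<noteq> w" "u \<in> set p" "w \<in> set p" by blast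
    have "2 * r u + \<epsilon> \<le> walk_length G p" "2 * r w + \<epsilon> \<le> walk_length G p"
      using tour_length_ge_two[of p u w] tour_length_ge_two[of p w u] uw p that(3) by auto
    \<comment> \<open>Only \<open>Suc kt\<close> may be closer than \<open>1 / 2\<close>, and
      \<open>u\<close> and \<open>w\<close> are not both equal to it.\<close>
    moreover have "r u = 1 / 2 \<or> r w = 1 / 2" using uw(1-3) by (auto simp: r_def)
    ultimately show ?thesis using p by (intro bexI[of _ p]) auto
  qed
  have trucks: "TSP \<alpha> G kt 0 {1..Suc kt} = 1 + \<epsilon>"
  proof (rule TSP_eqI)
    \<comment> \<open>One truck combines site \<open>1\<close> with the extra site, at cost
      \<open>1 / 2 + (1 / 2 - \<alpha> / 2 + \<epsilon>) + \<alpha> / 2\<close>.\<close>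
    let ?F = "([0, 1, Suc kt, 0] # map (\<lambda>i. [0, i, 0]) [2..<Suc kt], [])"
    have "tour G [0, 1, Suc kt, 0]"
      using assms(4) by (auto simp: tour_def walk_betw_def walk_def)
    then show "covering_family G kt 0 {1..Suc kt} ?F"
      using assms(4) by (auto simp: covering_family_def visited_def)
    have "walk_length G [0, 1, Suc kt, 0] = 1 + \<epsilon>"
      using assms(1,4) \<alpha> by (simp add: r_def)
    then show "makespan \<alpha> G ?F \<le> 1 + \<epsilon>"
      using assms(2)
      by (intro makespan_le) (auto simp: length_tour_site r_def simp del: walk_length_Cons2)
    fix F' assume "covering_family G kt 0 {1..Suc kt} F'"
    then have "\<exists>p \<in> set (fst F'). 1 + \<epsilon> \<le> walk_length G p"
      by (intro two) (auto simp: covering_family_def visited_def)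
    then show "1 + \<epsilon> \<le> makespan \<alpha> G F'" using makespan_ge_truck by (meson order_trans)
  qed
  have both: "TSP \<alpha> G kt kd {1..Suc kt} = 1"
  proof (rule TSP_eqI)
    let ?F = "(map (\<lambda>i. [0, i, 0]) [1..<Suc kt], replicate kd [0, Suc kt, 0])"
    show "covering_family G kt kd {1..Suc kt} ?F"
      using assms(5) by (auto simp: covering_family_def visited_def)
    show "makespan \<alpha> G ?F \<le> 1"
      using assms(4) \<alpha>
      by (intro makespan_le) (auto simp: length_tour_site r_def simp del: walk_length_Cons2)
    fix F' assume "covering_family G kt kd {1..Suc kt} F'"
    then show "1 \<le> makespan \<alpha> G F'"
    \<comment> \<open>Site \<open>1\<close> lies at distance \<open>1 / 2\<close>, so a truck needs
      at least time \<open>1\<close> for it, and a drone no less since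
      \<open>\<alpha> \<le> 1\<close>.\<close>
    proof (cases rule: covering_family_visits[of _ _ _ _ _ 1, consumes 1, case_names site truck drone])
      case (truck p)
      then show ?thesis
        using tour_length_ge[of p 1] makespan_ge_truck[of p F' G \<alpha>] assms(4) by (simp add: r_def)
    next
      case (drone p)
      then have "1 \<le> walk_length G p"
        using tour_length_ge[of p 1] assms(4) by (simp add: r_def)
      then have "1 \<le> 1 / \<alpha> * walk_length G p" using assms(1) \<alpha> by (simp add: field_simps)
      with drone show ?thesis using makespan_ge_drone[of p F' \<alpha> G] by linarith
    qed simp
  qed
  have inst: "rdp_instance kt kd \<alpha> G D" if "D \<subseteq> {1..Suc kt}" for D
    using assms \<alpha> rdp_graph that by (simp add: rdp_instance_def)
  note F = rule_covering_makespan[OF assms(6) inst[OF order_refl]]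
  have "\<not> {1..Suc kt} \<subseteq> visited (fst (S kt kd \<alpha> G))"
  proof
    assume "{1..Suc kt} \<subseteq> visited (fst (S kt kd \<alpha> G))"
    then obtain p where "p \<in> set (fst (S kt kd \<alpha> G))" "1 + \<epsilon> \<le> walk_length G p"
      using two[of "fst (S kt kd \<alpha> G)"] F(1) by (auto simp: covering_family_def)
    with makespan_ge_truck[of p "S kt kd \<alpha> G" G \<alpha>] F(2) both assms(2) show False by simp
  qed
  then obtain w where w: "w \<in> {1..Suc kt}" "w \<notin> visited (fst (S kt kd \<alpha> G))" by blast
  have "w \<in> sites G" using w(1) by simp
  from F(1) this have "2 * r w \<le> \<alpha>"
  proof (cases rule: covering_family_visits)
    case (truck p)
    then show ?thesis using w(2) by (auto simp: visited_def)
  next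
    case (drone p)
    then have "1 / \<alpha> * walk_length G p \<le> 1"
      using makespan_ge_drone[of p "S kt kd \<alpha> G" \<alpha> G] F(2) both by simp
    then have "walk_length G p \<le> \<alpha>" using \<alpha> by (simp add: field_simps)
    with tour_length_ge[OF drone(2,3)] show ?thesis by linarith
  qed
  \<comment> \<open>Both values of \<open>r\<close> on sites satisfy
    \<open>\<alpha> \<le> 2 * r w\<close>, so equality holds; for \<open>\<alpha> = 1\<close> the
    site \<open>w\<close> need not be \<open>Suc kt\<close>.\<close>
  then have "2 * r w = \<alpha>" using w(1) assms(1) by (auto simp: r_def split: if_splits)
  then have "TSP \<alpha> G kt 0 {w} = \<alpha>" using TSP_single_site[of w kt \<alpha>] w(1) assms(4) by simp
  moreover have "second_stage_nodes S kt kd \<alpha> G {w} = {w}"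
    using w(2) by (auto simp: second_stage_nodes_def)
  ultimately have "optimistic S kt kd \<alpha> G {w} = 1 + \<alpha>"
    using both by (simp add: optimistic_def)
  with inst[of "{w}"] trucks w(1) show thesis by (intro that[of G "{w}"]) simp_all
qed

theorem lemma13:
  fixes \<alpha> :: real and kt kd :: nat and S :: "nat rule"
  assumes "\<alpha> > 0" and "kt \<ge> 1" and "kd \<ge> 1"
    and "selection_rule S"
  shows "\<exists>\<epsilon>0 > 0. \<forall>\<epsilon> :: real. 0 < \<epsilon> \<and> \<epsilon> < \<epsilon>0 \<longrightarrow>
    (\<exists>(G :: nat network) D. rdp_instance kt kd \<alpha> G D \<and>
       optimistic S kt kd \<alpha> G D / TSP \<alpha> G kt 0 (sites G)
         = min (1 + 1 / \<alpha>) ((1 + \<alpha>) / (1 + \<epsilon>)))"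
proof (cases "\<alpha> > 1")
  case True
  show ?thesis
  \<comment> \<open>The bound \<open>\<epsilon> < \<alpha> - 1\<close> gives
    \<open>1 + \<epsilon> < \<alpha>\<close>, so the minimum is \<open>1 + 1 / \<alpha>\<close>; the
    instance does not depend on \<open>\<epsilon>\<close>.\<close>
  proof (intro exI[of _ "\<alpha> - 1"] conjI allI impI)
    fix \<epsilon> :: real assume \<epsilon>: "0 < \<epsilon> \<and> \<epsilon> < \<alpha> - 1"
    obtain G D where *: "rdp_instance kt kd \<alpha> G D"
      "optimistic S kt kd \<alpha> G D = 1 + \<alpha>" "TSP \<alpha> G kt 0 (sites G) = \<alpha>"
      using fast_drone_instance[OF True assms(2-4)] by blast
    have "(1 + \<alpha>) / \<alpha> \<le> (1 + \<alpha>) / (1 + \<epsilon>)" using \<epsilon> True by (intro divide_left_mono) auto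
    moreover have "(1 + \<alpha>) / \<alpha> = 1 + 1 / \<alpha>" using True by (simp add: field_simps)
    ultimately have "optimistic S kt kd \<alpha> G D / TSP \<alpha> G kt 0 (sites G)
        = min (1 + 1 / \<alpha>) ((1 + \<alpha>) / (1 + \<epsilon>))"
      unfolding *(2,3) by simp
    with *(1) show "\<exists>G D. rdp_instance kt kd \<alpha> G D \<and>
        optimistic S kt kd \<alpha> G D / TSP \<alpha> G kt 0 (sites G)
          = min (1 + 1 / \<alpha>) ((1 + \<alpha>) / (1 + \<epsilon>))"
      by (intro exI conjI)
  qed (use True in simp)
next
  case False
  then have "\<alpha> \<le> 1" by simp
  show ?thesis
  \<comment> \<open>The bound \<open>\<epsilon> < \<alpha>\<close> keeps the surcharge below
    \<open>2 * r u\<close> for every site; as \<open>\<alpha> \<le> 1 < 1 + \<epsilon>\<close>, the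
    minimum is now the second term.\<close>
  proof (intro exI[of _ \<alpha>] conjI allI impI)
    fix \<epsilon> :: real assume \<epsilon>: "0 < \<epsilon> \<and> \<epsilon> < \<alpha>"
    obtain G D where *: "rdp_instance kt kd \<alpha> G D"
      "optimistic S kt kd \<alpha> G D = 1 + \<alpha>" "TSP \<alpha> G kt 0 (sites G) = 1 + \<epsilon>"
      using slow_drone_instance[OF \<open>\<alpha> \<le> 1\<close> conjunct1[OF \<epsilon>] conjunct2[OF \<epsilon>] assms(2-4)] by blast
    have "(1 + \<alpha>) / (1 + \<epsilon>) \<le> (1 + \<alpha>) / \<alpha>"
      using \<epsilon> \<open>\<alpha> \<le> 1\<close> by (intro divide_left_mono) auto
    moreover have "(1 + \<alpha>) / \<alpha> = 1 + 1 / \<alpha>" using assms(1) by (simp add: field_simps)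
    ultimately have "optimistic S kt kd \<alpha> G D / TSP \<alpha> G kt 0 (sites G)
        = min (1 + 1 / \<alpha>) ((1 + \<alpha>) / (1 + \<epsilon>))"
      unfolding *(2,3) by simp
    with *(1) show "\<exists>G D. rdp_instance kt kd \<alpha> G D \<and>
        optimistic S kt kd \<alpha> G D / TSP \<alpha> G kt 0 (sites G)
          = min (1 + 1 / \<alpha>) ((1 + \<alpha>) / (1 + \<epsilon>))"
      by (intro exI conjI)
  qed (use assms(1) in simp)
qed

end
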